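(* Let $H$ be an $n$-dimensional reproducing kernel Hilbert space with reproducing kernels $\{k_i\}_{i=1}^n$, dual basis $\{f_i\}_{i=1}^n$, Gram matrix $K=(\langle k_i,k_j\rangle)$ and let $\Theta=(\theta_{ij})$ be the matrix with $f_i=\sum_j\theta_{ij}k_j$. Let $\Omega:H\to H$ be the conjugate linear map $\Omega(\sum\alpha_ik_i)=\sum\overline{\alpha_i}f_i$. The following are equivalent: (1) The matrix $K$ is orthogonal: $K^tK=\bar KK=I$. (2) With $\sigma=\sum_{i=1}^nk_i$, the matrix $(\langle k_ik_j,\sigma\rangle)_{i,j=1}^n$ is the identity. (3) $\Omega$ is an isometry of $H$ (i.e. $\|\Omega h\|=\|h\|$ for all $h$); equivalently $K^t=\Theta K\Theta^*$. (4) $\Omega$ is an involution of $H$ (i.e. $\Omega^2=\mathrm{id}$); equivalently $\Theta^t\Theta=\bar\Theta\Theta=I$. (5) $\Omega$ is a conjugation of $H$. (6) The linear map $S:\overline H\to H^{\#}$, $S(\sum\alpha_ik_i)=\sum\alpha_if_i$, is an isometry between $\overline H$ and $H^{\#}$.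
   Context: A finite dimensional reproducing kernel Hilbert space (RKHS) $H$ is a complex inner product space with a distinguished basis $\{k_i\}_{i=1}^n$ of vectors called reproducing kernels, indexed by a set $X(H)=\{x_i\}_{i=1}^n$; vectors $h\in H$ are regarded as functions on $X(H)$ via $h(x_i)=\langle h,k_i\rangle$ (so $H$ consists of all functions on $X(H)$, and $k_ik_j$ in (2) denotes the pointwise product, viewed as an element of $H$). It is assumed that any two kernels are linearly independent and that $\langle k_i,k_j\rangle\neq0$ for all $i,j$. The dual basis $\{f_j\}$ is defined by $\langle k_i,f_j\rangle=\delta_{ij}$ (Kronecker delta). A conjugation is a conjugate linear map $\Gamma:H\to H$ with $\Gamma^2=\mathrm{id}$ and $\|\Gamma h\|=\|h\|$ for all $h$. The conjugate space $\overline H$ is the same vector space with the same reproducing kernels $\{k_i\}$ but with the Hermitian inner product $[\cdot,\cdot]$ determined by $[k_i,k_j]=\overline{\langle k_i,k_j\rangle}$. The dualized space $H^{\#}$ is the Hilbert space $H$ (same inner product) with distinguished basis $\{f_i\}$ in place of $\{k_i\}$. $A^t$ is the transpose, $\bar A$ the entrywise conjugate and $A^*$ the adjoint of a matrix. *)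

theory Defs
  imports "HOL-Analysis.Analysis"
begin

locale complex_inner_space = vector_space s
  for s :: "complex \<Rightarrow> 'h::ab_group_add \<Rightarrow> 'h" +
  fixes ip :: "'h \<Rightarrow> 'h \<Rightarrow> complex"
  assumes ip_add_left: "ip (x + y) z = ip x z + ip y z"
    and ip_scale_left: "ip (s c x) z = c * ip x z"
    and ip_commute: "ip x y = cnj (ip y x)"
    and ip_nonneg: "0 \<le> Re (ip x x)"
    and ip_definite: "ip x x = 0 \<Longrightarrow> x = 0"

text \<open>
  A space is a whole type \<open>'h\<close> carrying a scalar multiplication, an inner product (linear in the
  first argument) and a distinguished basis, so that the same vectors can be given a different
  inner product or a different basis. The finite type \<open>'n\<close> plays the role of the index set
  \<open>{1,...,n}\<close> and, via \<open>i \<mapsto> x_i\<close>, of the point set \<open>X(H)\<close>.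
\<close>

record ('n, 'h) based_space =
  smul :: "complex \<Rightarrow> 'h \<Rightarrow> 'h"
  cinner :: "'h \<Rightarrow> 'h \<Rightarrow> complex"
  basis :: "'n \<Rightarrow> 'h"

locale based_inner_space = complex_inner_space "smul H" "cinner H"
  for H :: "('n::finite, 'h::ab_group_add) based_space" +
  assumes inj_basis: "inj (basis H)"
    and independent_basis: "independent (range (basis H))"
    and span_basis: "span (range (basis H)) = UNIV"

text \<open>
  That any two distinct kernels are linearly independent is part of \<open>independent_basis\<close>
  together with \<open>inj_basis\<close>.
\<close>

locale finite_rkhs = based_inner_space H
  for H :: "('n::finite, 'h::ab_group_add) based_space" +
  assumes kernels_nonorthogonal: "cinner H (basis H i) (basis H j) \<noteq> 0"

definition hnorm :: "('n, 'h) based_space \<Rightarrow> 'h \<Rightarrow> real" where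
  "hnorm H h = sqrt (Re (cinner H h h))"

definition eval_at :: "('n, 'h) based_space \<Rightarrow> 'h \<Rightarrow> 'n \<Rightarrow> complex" where
  "eval_at H h i = cinner H h (basis H i)"

definition pointwise_mult :: "('n, 'h) based_space \<Rightarrow> 'h \<Rightarrow> 'h \<Rightarrow> 'h" where
  "pointwise_mult H g h = (THE p. \<forall>i. eval_at H p i = eval_at H g i * eval_at H h i)"

definition coord :: "('n::finite, 'h::ab_group_add) based_space \<Rightarrow> 'h \<Rightarrow> 'n \<Rightarrow> complex" where
  "coord H h = (THE a. h = (\<Sum>i\<in>UNIV. smul H (a i) (basis H i)))"

definition dual_basis :: "('n, 'h) based_space \<Rightarrow> 'n \<Rightarrow> 'h" where
  "dual_basis H = (THE f. \<forall>i j. cinner H (basis H i) (f j) = (if i = j then 1 else 0))"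

definition gram :: "('n::finite, 'h) based_space \<Rightarrow> complex^'n^'n" where
  "gram H = (\<chi> i j. cinner H (basis H i) (basis H j))"

definition Theta :: "('n::finite, 'h::ab_group_add) based_space \<Rightarrow> complex^'n^'n" where
  "Theta H = (\<chi> i j. coord H (dual_basis H i) j)"

definition Omega :: "('n::finite, 'h::ab_group_add) based_space \<Rightarrow> 'h \<Rightarrow> 'h" where
  "Omega H h = (\<Sum>i\<in>UNIV. smul H (cnj (coord H h i)) (dual_basis H i))"

definition conjugate_space ::
  "('n::finite, 'h::ab_group_add) based_space \<Rightarrow> ('n, 'h) based_space" where
  "conjugate_space H = H\<lparr>cinner := \<lambda>g h. \<Sum>i\<in>UNIV. \<Sum>j\<in>UNIV.
     coord H g i * cnj (coord H h j) * cnj (cinner H (basis H i) (basis H j))\<rparr>"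

definition dualized_space ::
  "('n::finite, 'h::ab_group_add) based_space \<Rightarrow> ('n, 'h) based_space" where
  "dualized_space H = H\<lparr>basis := dual_basis H\<rparr>"

definition dual_map :: "('n::finite, 'h::ab_group_add) based_space \<Rightarrow> 'h \<Rightarrow> 'h" where
  "dual_map H h = (\<Sum>i\<in>UNIV. smul H (coord H h i) (dual_basis H i))"

definition conjugate_linear ::
  "('n, 'h::ab_group_add) based_space \<Rightarrow> ('h \<Rightarrow> 'h) \<Rightarrow> bool" where
  "conjugate_linear H T \<longleftrightarrow>
     (\<forall>g h. T (g + h) = T g + T h) \<and> (\<forall>c h. T (smul H c h) = smul H (cnj c) (T h))"

definition isometry_between ::
  "('n, 'h) based_space \<Rightarrow> ('n, 'h) based_space \<Rightarrow> ('h \<Rightarrow> 'h) \<Rightarrow> bool" where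
  "isometry_between G H T \<longleftrightarrow> (\<forall>h. hnorm H (T h) = hnorm G h)"

definition involution :: "('h \<Rightarrow> 'h) \<Rightarrow> bool" where
  "involution T \<longleftrightarrow> T \<circ> T = id"

definition conjugation ::
  "('n, 'h::ab_group_add) based_space \<Rightarrow> ('h \<Rightarrow> 'h) \<Rightarrow> bool" where
  "conjugation H T \<longleftrightarrow> conjugate_linear H T \<and> involution T \<and> isometry_between H H T"

definition conj_matrix :: "complex^'n^'m \<Rightarrow> complex^'n^'m" where
  "conj_matrix A = (\<chi> i j. cnj (A $ i $ j))"

definition adjoint_matrix :: "complex^'n^'m \<Rightarrow> complex^'m^'n" where
  "adjoint_matrix A = transpose (conj_matrix A)"

definition all_equivalent :: "bool list \<Rightarrow> bool" where
  "all_equivalent Ps \<longleftrightarrow> (\<forall>P\<in>set Ps. \<forall>Q\<in>set Ps. P \<longleftrightarrow> Q)"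


text \<open>
  The objects introduced above by a description or through coordinates exist and have the
  properties that are meant to characterize them.
\<close>

context complex_inner_space
begin

lemma ip_zero_left [simp]: "ip 0 z = 0"
  using ip_scale_left[of 0 0 z] by simp

lemma ip_sum_left: "ip (\<Sum>i\<in>A. g i) z = (\<Sum>i\<in>A. ip (g i) z)"
  by (induction A rule: infinite_finite_induct) (auto simp: ip_add_left)

lemma ip_add_right: "ip z (x + y) = ip z x + ip z y"
  by (metis ip_commute ip_add_left complex_cnj_add)

lemma ip_scale_right: "ip z (s c x) = cnj c * ip z x"
  by (metis ip_commute ip_scale_left complex_cnj_mult)

lemma ip_zero_right [simp]: "ip z 0 = 0"
  by (metis ip_commute ip_zero_left complex_cnj_zero)

lemma ip_sum_right: "ip z (\<Sum>i\<in>A. g i) = (\<Sum>i\<in>A. ip z (g i))"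
  by (induction A rule: infinite_finite_induct) (auto simp: ip_add_right)

lemma ip_diff_left: "ip (x - y) z = ip x z - ip y z"
  using ip_add_left[of "x - y" y z] by simp

end

context based_inner_space
begin

lemma basis_expansion_unique:
  assumes "(\<Sum>i\<in>UNIV. smul H (a i) (basis H i)) = (\<Sum>i\<in>UNIV. smul H (b i) (basis H i))"
  shows "a = b"
proof
  fix i
  let ?c = "\<lambda>v. a (inv (basis H) v) - b (inv (basis H) v)"
  have "(\<Sum>v\<in>range (basis H). smul H (?c v) v) = (\<Sum>i\<in>UNIV. smul H (a i - b i) (basis H i))"
    using inj_basis by (subst sum.reindex) (auto simp: inv_f_f o_def)
  also have "\<dots> = 0"
    using assms by (simp add: scale_left_diff_distrib sum_subtractf)
  finally have "?c (basis H i) = 0"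
    by (intro independentD[OF independent_basis, of "range (basis H)"]) auto
  then show "a i = b i"
    using inj_basis by (simp add: inv_f_f)
qed

lemma basis_expansion_exists: "\<exists>a. h = (\<Sum>i\<in>UNIV. smul H (a i) (basis H i))"
proof -
  have "h \<in> span (range (basis H))"
    by (simp add: span_basis)
  then obtain u where "h = (\<Sum>v\<in>range (basis H). smul H (u v) v)"
    by (auto simp: span_finite)
  then have "h = (\<Sum>i\<in>UNIV. smul H (u (basis H i)) (basis H i))"
    using inj_basis by (simp add: sum.reindex)
  then show ?thesis by (rule exI[where x = "\<lambda>i. u (basis H i)"])
qed

lemma coord_sum [simp]: "coord H (\<Sum>i\<in>UNIV. smul H (a i) (basis H i)) = a"
  unfolding coord_def by (rule the_equality) (auto dest: basis_expansion_unique)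

lemma sum_coord: "(\<Sum>i\<in>UNIV. smul H (coord H h i) (basis H i)) = h"
  using basis_expansion_exists[of h] by auto

lemma coord_add: "coord H (g + h) = (\<lambda>i. coord H g i + coord H h i)"
  by (rule basis_expansion_unique) (simp add: sum_coord scale_left_distrib sum.distrib)

lemma coord_scale: "coord H (smul H c h) = (\<lambda>i. c * coord H h i)"
  by (rule basis_expansion_unique)
    (simp add: sum_coord flip: scale_scale scale_sum_right)

lemma coord_basis: "coord H (basis H i) = (\<lambda>j. if j = i then 1 else 0)"
proof -
  have "basis H i = (\<Sum>j\<in>UNIV. smul H (if j = i then 1 else 0) (basis H j))"
    by (simp add: if_distrib[of "\<lambda>c. smul H c _"] cong: if_cong)
  then show ?thesis using coord_sum by metis
qed

lemma cinner_sum_sum: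
  "cinner H (\<Sum>i\<in>UNIV. smul H (a i) (basis H i)) (\<Sum>j\<in>UNIV. smul H (b j) (basis H j)) =
     (\<Sum>i\<in>UNIV. \<Sum>j\<in>UNIV. a i * cnj (b j) * cinner H (basis H i) (basis H j))"
  by (subst sum.swap) (simp add: ip_sum_left ip_sum_right ip_scale_left ip_scale_right
      sum_distrib_left mult_ac)

lemma eval_at_inject:
  assumes "\<And>i. eval_at H g i = eval_at H h i"
  shows "g = h"
proof -
  have "cinner H (g - h) (basis H i) = 0" for i
    using assms[of i] by (simp add: eval_at_def ip_diff_left)
  then have "cinner H (g - h) (\<Sum>i\<in>UNIV. smul H (a i) (basis H i)) = 0" for a
    by (simp add: ip_sum_right ip_scale_right)
  then have "cinner H (g - h) (g - h) = 0"
    by (metis sum_coord)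
  then show ?thesis using ip_definite by fastforce
qed

lemma eval_at_surj: "\<exists>h. \<forall>i. eval_at H h i = u i"
proof -
  let ?M = "transpose (gram H)"
  have ev: "?M *v x = (\<chi> i. eval_at H (\<Sum>j\<in>UNIV. smul H (x $ j) (basis H j)) i)" for x
    by (simp add: vec_eq_iff matrix_vector_mult_def transpose_def gram_def eval_at_def
        ip_sum_left ip_scale_left mult.commute)
  have "x = 0" if "?M *v x = 0" for x
  proof -
    have "(\<Sum>j\<in>UNIV. smul H (x $ j) (basis H j)) = 0"
      using that[unfolded ev] by (intro eval_at_inject) (simp add: vec_eq_iff eval_at_def)
    then have "(\<lambda>j. x $ j) = (\<lambda>j. 0)"
      by (intro basis_expansion_unique[of "\<lambda>j. x $ j" "\<lambda>j. 0"]) simp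
    then show ?thesis by (simp add: vec_eq_iff fun_eq_iff)
  qed
  then obtain B where "B ** ?M = mat 1"
    using matrix_left_invertible_ker by metis
  then have "?M ** B = mat 1"
    by (simp add: matrix_left_right_inverse)
  then have "?M *v (B *v (\<chi> i. u i)) = (\<chi> i. u i)"
    by (simp add: matrix_vector_mul_assoc)
  then show ?thesis
    unfolding ev vec_eq_iff by auto
qed

lemma eval_at_pointwise_mult: "eval_at H (pointwise_mult H g h) i = eval_at H g i * eval_at H h i"
proof -
  have "\<exists>!p. \<forall>i. eval_at H p i = eval_at H g i * eval_at H h i"
    using eval_at_surj[of "\<lambda>i. eval_at H g i * eval_at H h i"] by (auto intro: eval_at_inject)
  then show ?thesis
    unfolding pointwise_mult_def by (rule theI'[THEN spec])
qed

lemma cinner_dual_basis: "cinner H (basis H i) (dual_basis H j) = (if i = j then 1 else 0)"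
proof -
  have "\<exists>!f. \<forall>i j. cinner H (basis H i) (f j) = (if i = j then 1 else 0)"
  proof (rule ex_ex1I)
    have "\<forall>j. \<exists>h. \<forall>i. eval_at H h i = (if i = j then 1 else 0)"
      by (intro allI eval_at_surj)
    then obtain f where "\<forall>j i. eval_at H (f j) i = (if i = j then 1 else 0)"
      by metis
    then have "\<forall>i j. cinner H (basis H i) (f j) = (if i = j then 1 else 0)"
      by (subst ip_commute) (simp add: eval_at_def)
    then show "\<exists>f. \<forall>i j. cinner H (basis H i) (f j) = (if i = j then 1 else 0)"
      by (rule exI[where x = f])
  next
    fix f g
    assume "\<forall>i j. cinner H (basis H i) (f j) = (if i = j then 1 else 0)"
      and "\<forall>i j. cinner H (basis H i) (g j) = (if i = j then 1 else 0)"
    then have "eval_at H (f j) i = eval_at H (g j) i" for i j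
      unfolding eval_at_def by (metis ip_commute)
    then show "f = g" by (blast intro: eval_at_inject)
  qed
  then have "\<forall>i j. cinner H (basis H i) (dual_basis H j) = (if i = j then 1 else 0)"
    unfolding dual_basis_def by (rule theI')
  then show ?thesis by blast
qed

lemma dual_basis_expansion:
  "dual_basis H i = (\<Sum>j\<in>UNIV. smul H (Theta H $ i $ j) (basis H j))"
  by (simp add: Theta_def sum_coord)

lemma Omega_sum:
  "Omega H (\<Sum>i\<in>UNIV. smul H (a i) (basis H i)) = (\<Sum>i\<in>UNIV. smul H (cnj (a i)) (dual_basis H i))"
  by (simp add: Omega_def)

lemma conjugate_linear_Omega: "conjugate_linear H (Omega H)"
  by (simp add: conjugate_linear_def Omega_def coord_add coord_scale scale_left_distrib
      sum.distrib flip: scale_scale scale_sum_right)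

lemma dual_map_sum:
  "dual_map H (\<Sum>i\<in>UNIV. smul H (a i) (basis H i)) = (\<Sum>i\<in>UNIV. smul H (a i) (dual_basis H i))"
  by (simp add: dual_map_def)

lemma linear_dual_map: "Vector_Spaces.linear (smul H) (smul H) (dual_map H)"
  unfolding Vector_Spaces.linear_iff using vector_space_axioms
  by (simp add: dual_map_def coord_add coord_scale scale_left_distrib
      sum.distrib flip: scale_scale scale_sum_right)

lemma cinner_conjugate_space_basis:
  "cinner (conjugate_space H) (basis H i) (basis H j) = cnj (cinner H (basis H i) (basis H j))"
proof -
  have "cnj (if l = j then 1 else 0) * c = (if l = j then c else 0)"
    and "(if l = j then 1 else 0) * c = (if l = j then c else 0)" for l j :: 'n and c
    by auto
  then show ?thesis
    by (simp add: conjugate_space_def coord_basis mult.assoc flip: sum_distrib_left)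
qed

lemma based_inner_space_conjugate_space: "based_inner_space (conjugate_space H)"
proof -
  define C where "C h = (\<Sum>i\<in>UNIV. smul H (cnj (coord H h i)) (basis H i))" for h
  have eq: "cinner (conjugate_space H) g h = cnj (cinner H (C g) (C h))" for g h
    by (simp add: C_def cinner_sum_sum conjugate_space_def)
  have sel: "smul (conjugate_space H) = smul H" "basis (conjugate_space H) = basis H"
    by (simp_all add: conjugate_space_def)
  have C_add: "C (g + h) = C g + C h" for g h
    by (simp add: C_def coord_add scale_left_distrib sum.distrib)
  have C_scale: "C (smul H c h) = smul H (cnj c) (C h)" for c h
    by (simp add: C_def coord_scale flip: scale_scale scale_sum_right)
  have C_zero: "h = 0" if "C h = 0" for h
  proof -
    have "(\<lambda>i. cnj (coord H h i)) = (\<lambda>i. 0)"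
      using that by (intro basis_expansion_unique) (simp add: C_def)
    then have "coord H h = (\<lambda>i. 0)" by (simp add: fun_eq_iff)
    then show ?thesis using sum_coord[of h] by simp
  qed
  show ?thesis
  proof (unfold_locales, goal_cases)
    case 7 show ?case unfolding eq by (metis ip_commute complex_cnj_cnj)
  qed (use inj_basis independent_basis span_basis ip_definite C_zero
      in \<open>auto simp: eq sel C_add C_scale ip_add_left ip_scale_left ip_nonneg
        scale_left_distrib scale_right_distrib\<close>)
qed

lemma based_inner_space_dualized_space: "based_inner_space (dualized_space H)"
proof -
  have zero: "a i = 0" if "(\<Sum>i\<in>UNIV. smul H (a i) (dual_basis H i)) = 0" for a i
  proof -
    have "0 = cinner H (basis H i) (\<Sum>i\<in>UNIV. smul H (a i) (dual_basis H i))"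
      using that by simp
    also have "\<dots> = cnj (a i)"
      by (simp add: ip_sum_right ip_scale_right cinner_dual_basis
          if_distrib[of "\<lambda>c. _ * c"] cong: if_cong)
    finally show ?thesis by simp
  qed
  have inj: "inj (dual_basis H)"
    by (rule injI) (metis cinner_dual_basis zero_neq_one)
  have ind: "independent (range (dual_basis H))"
  proof (rule independent_if_scalars_zero)
    fix c v
    assume c: "(\<Sum>v\<in>range (dual_basis H). smul H (c v) v) = 0" and v: "v \<in> range (dual_basis H)"
    have "(\<Sum>i\<in>UNIV. smul H (c (dual_basis H i)) (dual_basis H i)) = 0"
      using c inj by (simp add: sum.reindex)
    then show "c v = 0" using zero[of "\<lambda>i. c (dual_basis H i)"] v by auto
  qed simp
  have exp: "h = (\<Sum>i\<in>UNIV. smul H (cinner H h (basis H i)) (dual_basis H i))" for h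
  proof (rule eval_at_inject)
    fix i
    have "cinner H (dual_basis H j) (basis H i) = (if i = j then 1 else 0)" for j
      by (subst ip_commute) (simp add: cinner_dual_basis)
    then show "eval_at H h i =
        eval_at H (\<Sum>i\<in>UNIV. smul H (cinner H h (basis H i)) (dual_basis H i)) i"
      by (simp add: eval_at_def ip_sum_left ip_scale_left
          if_distrib[of "\<lambda>c. _ * c"] cong: if_cong)
  qed
  have sp: "h \<in> span (range (dual_basis H))" for h
    by (subst exp) (intro span_sum span_scale span_base rangeI)
  have "complex_inner_space (smul H) (cinner H)"
    by (rule complex_inner_space_axioms)
  then show ?thesis
    using inj ind sp
    by (simp add: based_inner_space_def based_inner_space_axioms_def dualized_space_def set_eq_iff)
qed

end

lemma (in finite_rkhs) finite_rkhs_conjugate_space: "finite_rkhs (conjugate_space H)"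
proof -
  have "basis (conjugate_space H) = basis H"
    by (simp add: conjugate_space_def)
  then show ?thesis
    using based_inner_space_conjugate_space kernels_nonorthogonal
    by (simp add: finite_rkhs_def finite_rkhs_axioms_def cinner_conjugate_space_basis)
qed

end

theory Submission
  imports Defs
begin

text \<open>
  All conditions are reduced to the single matrix equation \<open>transpose K = \<Theta>\<close>. Here \<open>\<Theta>\<close> is the inverse
  of \<open>K\<close> and also the Gram matrix of the dual basis, and both matrices are Hermitian. The isometry
  conditions compare the Hermitian forms of two Gram matrices, and such a form determines its matrix
  by polarization. The square of \<open>\<Omega>\<close> acts on coordinate vectors by \<open>transpose \<Theta> ** \<Theta>\<close>. In condition (2),
  pairing with \<open>\<sigma>\<close> sums a function over the point set, so the matrix there is \<open>K ** transpose K\<close>.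
\<close>

lemma conj_matrix_involution [simp]: "conj_matrix (conj_matrix A) = A"
  by (simp add: conj_matrix_def vec_eq_iff)

text \<open>A left inverse of a square matrix is two-sided, so \<open>C = C ** A ** B = B\<close>.
  This turns the product conditions into equations between \<open>K\<close>, \<open>\<Theta>\<close>
  and their transposes.\<close>

lemma matrix_inverse_unique:
  fixes A B C :: "'a::field^'n^'n"
  assumes "B ** A = mat 1"
  shows "C ** A = mat 1 \<longleftrightarrow> C = B"
  using assms by (metis matrix_left_right_inverse matrix_mul_assoc matrix_mul_rid)

text \<open>Polarization: the two cross terms of \<open>B (a + b) (a + b)\<close> are conjugate to
  each other, so they add up to \<open>2 * Re (B a b)\<close>, which therefore vanishes for all
  \<open>a\<close> and \<open>b\<close>.\<close>

lemma hermitian_form_eq_0: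
  fixes A :: "complex^'n^'n"
  assumes herm: "conj_matrix A = transpose A"
    and form: "\<And>a. Re (\<Sum>i\<in>UNIV. \<Sum>j\<in>UNIV. a i * cnj (a j) * A $ i $ j) = 0"
  shows "A = 0"
proof -
  define B where "B a b = (\<Sum>i\<in>UNIV. \<Sum>j\<in>UNIV. a i * cnj (b j) * A $ i $ j)" for a b :: "'n \<Rightarrow> complex"
  have form': "Re (B a a) = 0" for a
    unfolding B_def by (rule form)
  have A: "cnj (A $ i $ j) = A $ j $ i" for i j
    using herm by (simp add: conj_matrix_def transpose_def vec_eq_iff)
  have comm: "B b a = cnj (B a b)" for a b
    unfolding B_def by (subst sum.swap) (simp add: A mult_ac)
  have "B (\<lambda>i. a i + b i) (\<lambda>i. a i + b i) = B a a + B a b + B b a + B b b" for a b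
    by (simp add: B_def algebra_simps sum.distrib)
  then have "Re (B a b) = 0" for a b
    using form'[of "\<lambda>i. a i + b i"] form'[of a] form'[of b] comm[of b a] by simp
  \<comment> \<open>Scaling the second unit vector by \<open>A $ p $ q\<close> makes the value a
    squared modulus, so its real part alone forces the entry to be 0.\<close>
  moreover have "B (\<lambda>i. if i = p then 1 else 0) (\<lambda>j. if j = q then A $ p $ q else 0)
      = A $ p $ q * cnj (A $ p $ q)" for p q
    by (simp add: B_def if_distrib[of cnj] if_distrib[of "\<lambda>c. _ * c"]
        if_distrib[of "\<lambda>c. c * _"] cong: if_cong)
  ultimately have "Re (A $ p $ q * cnj (A $ p $ q)) = 0" for p q
    by metis
  then have "A $ p $ q = 0" for p q
    by (metis complex_norm_square Re_complex_of_real norm_eq_zero power_eq_0_iff)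
  then show ?thesis
    by (simp add: vec_eq_iff)
qed

lemma hermitian_form_inject:
  fixes A B :: "complex^'n^'n"
  assumes "conj_matrix A = transpose A" and "conj_matrix B = transpose B"
  shows "(\<forall>a. Re (\<Sum>i\<in>UNIV. \<Sum>j\<in>UNIV. a i * cnj (a j) * A $ i $ j)
      = Re (\<Sum>i\<in>UNIV. \<Sum>j\<in>UNIV. a i * cnj (a j) * B $ i $ j)) \<longleftrightarrow> A = B"
    (is "?L \<longleftrightarrow> _")
proof
  assume ?L
  have "A - B = 0"
  proof (rule hermitian_form_eq_0)
    show "conj_matrix (A - B) = transpose (A - B)"
      using assms by (simp add: conj_matrix_def transpose_def vec_eq_iff)
    show "Re (\<Sum>i\<in>UNIV. \<Sum>j\<in>UNIV. a i * cnj (a j) * (A - B) $ i $ j) = 0" for a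
      using \<open>?L\<close>[rule_format, of a]
      by (simp add: right_diff_distrib sum_subtractf del: Re_sum)
  qed
  then show "A = B" by simp
qed simp

context based_inner_space
begin

lemma conj_gram: "conj_matrix (gram H) = transpose (gram H)"
  by (simp add: conj_matrix_def transpose_def gram_def vec_eq_iff ip_commute[symmetric])

lemma cinner_dual_basis_right: "cinner H (dual_basis H i) (basis H j) = (if i = j then 1 else 0)"
  by (subst ip_commute) (auto simp: cinner_dual_basis)

text \<open>Expanding the dual vector in the kernels turns each entry of the product into the
  pairing of a dual vector with a kernel.\<close>

lemma Theta_gram: "Theta H ** gram H = mat 1"
proof -
  have "(\<Sum>k\<in>UNIV. Theta H $ i $ k * gram H $ k $ j) = cinner H (dual_basis H i) (basis H j)" for i j
    by (subst dual_basis_expansion) (simp add: ip_sum_left ip_scale_left gram_def)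
  then show ?thesis
    by (simp add: matrix_matrix_mult_def mat_def vec_eq_iff cinner_dual_basis_right)
qed

text \<open>Only the first vector is expanded in kernels; biorthogonality with the second picks out
  one coefficient.\<close>

lemma cinner_dual_basis_dual_basis: "cinner H (dual_basis H i) (dual_basis H j) = Theta H $ i $ j"
  by (subst dual_basis_expansion[of i])
    (simp add: ip_sum_left ip_scale_left cinner_dual_basis if_distrib[of "\<lambda>c. _ * c"] cong: if_cong)

lemma conj_Theta: "conj_matrix (Theta H) = transpose (Theta H)"
  by (simp add: conj_matrix_def transpose_def vec_eq_iff ip_commute[symmetric]
      flip: cinner_dual_basis_dual_basis)

lemma cinner_dual_sum_sum:
  "cinner H (\<Sum>i\<in>UNIV. smul H (a i) (dual_basis H i)) (\<Sum>j\<in>UNIV. smul H (b j) (dual_basis H j)) =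
     (\<Sum>i\<in>UNIV. \<Sum>j\<in>UNIV. a i * cnj (b j) * Theta H $ i $ j)"
  using based_inner_space.cinner_sum_sum[OF based_inner_space_dualized_space, of a b]
  by (simp add: dualized_space_def cinner_dual_basis_dual_basis)

text \<open>Every family of scalars is the coordinate family of some vector, so ranging over
  \<open>h\<close> tests all coefficients.\<close>

lemma hermitian_form_coord_inject:
  assumes "conj_matrix A = transpose A" and "conj_matrix B = transpose B"
  shows "(\<forall>h. Re (\<Sum>i\<in>UNIV. \<Sum>j\<in>UNIV. coord H h i * cnj (coord H h j) * A $ i $ j)
      = Re (\<Sum>i\<in>UNIV. \<Sum>j\<in>UNIV. coord H h i * cnj (coord H h j) * B $ i $ j)) \<longleftrightarrow> A = B"
  unfolding hermitian_form_inject[OF assms, symmetric]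
proof (intro iffI allI)
  fix a :: "'n \<Rightarrow> complex"
  assume "\<forall>h. Re (\<Sum>i\<in>UNIV. \<Sum>j\<in>UNIV. coord H h i * cnj (coord H h j) * A $ i $ j)
      = Re (\<Sum>i\<in>UNIV. \<Sum>j\<in>UNIV. coord H h i * cnj (coord H h j) * B $ i $ j)"
  from this[rule_format, of "\<Sum>i\<in>UNIV. smul H (a i) (basis H i)"]
  show "Re (\<Sum>i\<in>UNIV. \<Sum>j\<in>UNIV. a i * cnj (a j) * A $ i $ j)
      = Re (\<Sum>i\<in>UNIV. \<Sum>j\<in>UNIV. a i * cnj (a j) * B $ i $ j)"
    by (simp only: coord_sum)
qed blast

text \<open>Conjugating the coordinates swaps the two indices of the form, hence the transpose on
  \<open>Theta H\<close>.\<close>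

lemma isometry_Omega_iff: "isometry_between H H (Omega H) \<longleftrightarrow> transpose (Theta H) = gram H"
proof -
  have "cinner H (Omega H h) (Omega H h) =
      (\<Sum>i\<in>UNIV. \<Sum>j\<in>UNIV. coord H h i * cnj (coord H h j) * transpose (Theta H) $ i $ j)" for h
    unfolding Omega_def cinner_dual_sum_sum
    by (subst sum.swap) (simp add: transpose_def mult_ac)
  moreover have "cinner H h h =
      (\<Sum>i\<in>UNIV. \<Sum>j\<in>UNIV. coord H h i * cnj (coord H h j) * gram H $ i $ j)" for h
    using cinner_sum_sum[of "coord H h" "coord H h"] by (simp add: sum_coord gram_def)
  moreover have "conj_matrix (transpose (Theta H)) = transpose (transpose (Theta H))"
    by (metis conj_Theta conj_matrix_involution transpose_transpose)
  ultimately show ?thesis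
    unfolding isometry_between_def hnorm_def real_sqrt_eq_iff
    using hermitian_form_coord_inject conj_gram by (simp del: Re_sum)
qed

text \<open>Here the coordinates stay unconjugated; the transpose arises on the other side, from the
  conjugated inner product and the Hermitian symmetry of \<open>gram H\<close>.\<close>

lemma isometry_dual_map_iff:
  "isometry_between (conjugate_space H) (dualized_space H) (dual_map H)
    \<longleftrightarrow> Theta H = transpose (gram H)"
proof -
  have "cinner (dualized_space H) (dual_map H h) (dual_map H h) =
      (\<Sum>i\<in>UNIV. \<Sum>j\<in>UNIV. coord H h i * cnj (coord H h j) * Theta H $ i $ j)" for h
    by (simp add: dualized_space_def dual_map_def cinner_dual_sum_sum)
  moreover have "cinner (conjugate_space H) h h =
      (\<Sum>i\<in>UNIV. \<Sum>j\<in>UNIV. coord H h i * cnj (coord H h j) * transpose (gram H) $ i $ j)" for h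
    by (simp add: conjugate_space_def gram_def transpose_def ip_commute[symmetric])
  moreover have "conj_matrix (transpose (gram H)) = transpose (transpose (gram H))"
    by (metis conj_gram conj_matrix_involution transpose_transpose)
  ultimately show ?thesis
    unfolding isometry_between_def hnorm_def real_sqrt_eq_iff
    using hermitian_form_coord_inject conj_Theta by (simp del: Re_sum)
qed

lemma coord_Omega:
  "(\<chi> j. coord H (Omega H h) j) = transpose (Theta H) *v (\<chi> i. cnj (coord H h i))"
proof -
  have "Omega H h = (\<Sum>j\<in>UNIV. smul H (\<Sum>i\<in>UNIV. cnj (coord H h i) * Theta H $ i $ j) (basis H j))"
    unfolding Omega_def dual_basis_expansion
    by (simp add: scale_sum_right scale_sum_left) (rule sum.swap)
  then show ?thesis
    by (simp add: matrix_vector_mult_def transpose_def vec_eq_iff mult.commute)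
qed

lemma involution_Omega_iff: "involution (Omega H) \<longleftrightarrow> transpose (Theta H) ** Theta H = mat 1"
proof -
  define v where "v h = (\<chi> j. coord H h j)" for h
  have v_inject: "v g = v h \<longleftrightarrow> g = h" for g h
  proof
    assume "v g = v h"
    then have "coord H g = coord H h" by (simp add: v_def vec_eq_iff fun_eq_iff)
    then show "g = h" by (metis sum_coord)
  qed simp
  have v_surj: "x = v (\<Sum>i\<in>UNIV. smul H (x $ i) (basis H i))" for x
    by (simp add: v_def)
  have "conj_matrix (transpose (Theta H)) = Theta H"
    by (metis conj_Theta conj_matrix_involution)
  \<comment> \<open>Between the two applications of \<open>Omega H\<close>, the conjugation moves
    past the inner matrix \<open>transpose (Theta H)\<close> and turns it into
    \<open>Theta H\<close>.\<close>
  moreover have "(\<chi> i. cnj ((A *v (\<chi> i. cnj (x $ i))) $ i)) = conj_matrix A *v x"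
    for A :: "complex^'n^'n" and x
    by (simp add: conj_matrix_def matrix_vector_mult_def vec_eq_iff)
  moreover have "v (Omega H h) = transpose (Theta H) *v (\<chi> i. cnj (v h $ i))" for h
    by (simp add: v_def coord_Omega)
  ultimately have "v (Omega H (Omega H h)) = (transpose (Theta H) ** Theta H) *v v h" for h
    by (simp del: transpose_matrix_vector flip: matrix_vector_mul_assoc)
  then have "involution (Omega H) \<longleftrightarrow> (\<forall>h. (transpose (Theta H) ** Theta H) *v v h = v h)"
    unfolding involution_def fun_eq_iff o_def id_def v_inject[symmetric] by simp
  also have "\<dots> \<longleftrightarrow> (\<forall>x. (transpose (Theta H) ** Theta H) *v x = x)"
    using v_surj by metis
  finally show ?thesis
    by (simp add: matrix_eq)
qed

text \<open>The product of kernels \<open>i\<close> and \<open>j\<close> has the value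
  \<open>gram H $ i $ l * gram H $ j $ l\<close> at the point \<open>l\<close>; these are summed
  over \<open>l\<close>.\<close>

lemma cinner_pointwise_mult_sum_basis:
  "(\<chi> i j. cinner H (pointwise_mult H (basis H i) (basis H j)) (\<Sum>l\<in>UNIV. basis H l))
    = gram H ** transpose (gram H)"
proof -
  have "cinner H p (\<Sum>l\<in>UNIV. basis H l) = (\<Sum>l\<in>UNIV. eval_at H p l)" for p
    by (simp add: ip_sum_right eval_at_def)
  then show ?thesis
    by (simp add: eval_at_pointwise_mult matrix_matrix_mult_def transpose_def vec_eq_iff)
      (simp add: gram_def eval_at_def)
qed

end

theorem theorem9:
  fixes H :: "('n::finite, 'h::ab_group_add) based_space"
    and K \<Theta> :: "complex^'n^'n"
    and \<sigma> :: 'h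
  assumes "finite_rkhs H"
    and "K = gram H"
    and "\<Theta> = Theta H"
    and "\<sigma> = (\<Sum>i\<in>UNIV. basis H i)"
  shows "all_equivalent
    [orthogonal_matrix K,
     transpose K ** K = mat 1,
     conj_matrix K ** K = mat 1,
     (\<chi> i j. cinner H (pointwise_mult H (basis H i) (basis H j)) \<sigma>) = (mat 1 :: complex^'n^'n),
     isometry_between H H (Omega H),
     transpose K = \<Theta> ** K ** adjoint_matrix \<Theta>,
     involution (Omega H),
     transpose \<Theta> ** \<Theta> = mat 1,
     conj_matrix \<Theta> ** \<Theta> = mat 1,
     conjugation H (Omega H),
     isometry_between (conjugate_space H) (dualized_space H) (dual_map H)]"
proof -
  interpret finite_rkhs H by fact
  define E where "E \<longleftrightarrow> transpose K = \<Theta>"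
  have \<Theta>K: "\<Theta> ** K = mat 1" and K\<Theta>: "K ** \<Theta> = mat 1"
    using Theta_gram assms by (simp_all add: matrix_left_right_inverse)
  have cK: "conj_matrix K = transpose K" and c\<Theta>: "conj_matrix \<Theta> = transpose \<Theta>"
    using conj_gram conj_Theta assms by simp_all
  have t: "transpose \<Theta> = K \<longleftrightarrow> E"
    unfolding E_def by (metis transpose_transpose)
  have 1: "transpose K ** K = mat 1 \<longleftrightarrow> E"
    unfolding E_def by (rule matrix_inverse_unique[OF \<Theta>K])
  have 2: "K ** transpose K = mat 1 \<longleftrightarrow> E"
    using 1 matrix_left_right_inverse by blast
  \<comment> \<open>With \<open>K\<close> and \<open>\<Theta>\<close> exchanged, uniqueness of
    inverses gives \<open>transpose \<Theta> = K\<close>, the transposed form of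
    \<open>E\<close>.\<close>
  have 3: "transpose \<Theta> ** \<Theta> = mat 1 \<longleftrightarrow> E"
    using matrix_inverse_unique[OF K\<Theta>] t by simp
  \<comment> \<open>The first two factors cancel, and the Hermitian \<open>\<Theta>\<close> is its
    own adjoint.\<close>
  have "\<Theta> ** K ** adjoint_matrix \<Theta> = \<Theta>"
    by (simp add: \<Theta>K adjoint_matrix_def c\<Theta>)
  then have 4: "transpose K = \<Theta> ** K ** adjoint_matrix \<Theta> \<longleftrightarrow> E"
    by (simp add: E_def)
  have 5: "isometry_between H H (Omega H) \<longleftrightarrow> E"
    using isometry_Omega_iff t assms by simp
  have 6: "involution (Omega H) \<longleftrightarrow> E"
    using involution_Omega_iff 3 assms by simp
  have 7: "conjugation H (Omega H) \<longleftrightarrow> E"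
    by (simp add: conjugation_def conjugate_linear_Omega 5 6)
  have 8: "isometry_between (conjugate_space H) (dualized_space H) (dual_map H) \<longleftrightarrow> E"
    using isometry_dual_map_iff assms by (auto simp: E_def)
  have 9: "(\<chi> i j. cinner H (pointwise_mult H (basis H i) (basis H j)) \<sigma>) = (mat 1 :: complex^'n^'n)
      \<longleftrightarrow> E"
    using cinner_pointwise_mult_sum_basis 2 assms by simp
  \<comment> \<open>\<open>orthogonal_matrix\<close> asks for both products, given by 1 and 2; the
    entrywise conjugates become transposes.\<close>
  show ?thesis
    by (simp add: all_equivalent_def orthogonal_matrix_def cK c\<Theta> 1 2 3 4 5 6 7 8 9)
qed

end
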